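(* Let $d\ge1$ and $p\ge 1$. There is a constant $C=C(p,d)$, depending only on $p$ and $d$, such that the following holds. For any $f\in L^1(\mathbb{R}^d)$ satisfying $$|f(x)-f(y)|\le |x-y|\exp\{g(x)+g(y)\}\qquad\text{for all }x,y\in\mathbb{R}^d,\ \text{for some } g\in L^p(\mathbb{R}^d),$$ one has $$\int_{B_{1/3}}\int_{\mathbb{R}^d}\frac{1\wedge|f(x+h)-f(x)|^2}{|h|^d}\,\frac{1}{\log(1/|h|)^{1-p}}\,dx\,dh\le C\left(\|g\|_{L^p}^p+\|f\|_{L^1}\right).$$
   Context: $B_r$ is the ball of radius $r$ in $\mathbb{R}^d$ centered at the origin, and $a\wedge b=\min\{a,b\}$. *)

theory Defs
  imports "HOL-Analysis.Analysis"
begin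

text \<open>Elements of the Lebesgue spaces are represented by everywhere-defined real functions that are
  measurable for the completed Lebesgue measure. Only finite exponents are covered.\<close>

definition Lp_space :: "real \<Rightarrow> ('a::euclidean_space \<Rightarrow> real) set" where
  "Lp_space p = {u \<in> borel_measurable lebesgue. integrable lebesgue (\<lambda>x. \<bar>u x\<bar> powr p)}"

definition Lp_norm :: "real \<Rightarrow> ('a::euclidean_space \<Rightarrow> real) \<Rightarrow> real" where
  "Lp_norm p u = (LINT x|lebesgue. \<bar>u x\<bar> powr p) powr (1 / p)"

end

theory Submission
  imports Defs "HOL-Real_Asymp.Real_Asymp"
begin

text \<open>
  Put \<open>L = ln (1 / \<bar>h\<bar>)\<close> and decompose the ball into the shells on which \<open>k \<le> L < k + 1\<close>, \<open>k \<ge> 1\<close>.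
  Where \<open>g x\<close> and \<open>g (x + h)\<close> are both at most \<open>k / 4\<close>, the hypothesis gives
  \<open>\<bar>f (x + h) - f x\<bar> \<le> exp (- k / 2)\<close>, so that
  \<open>\<bar>f (x + h) - f x\<bar>\<^sup>2 \<le> exp (- k / 2) (\<bar>f (x + h)\<bar> + \<bar>f x\<bar>)\<close>; the exponential gain makes the sum over
  the shells converge to a multiple of the \<open>L\<^sup>1\<close> norm of \<open>f\<close>. Elsewhere the numerator is bounded by 1,
  which costs \<open>2 |{g > k / 4}|\<close> after integration in \<open>x\<close>. Each shell has measure
  \<open>O(1)\<close> for \<open>dh / \<bar>h\<bar>\<^sup>d\<close>, so these terms sum to a multiple of
  \<open>\<Sum>k. (k + 1) powr (p - 1) * |{g > k / 4}|\<close>, which the layer-cake formula bounds by the \<open>p\<close>-th power of the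
  \<open>L\<^sup>p\<close> norm of \<open>g\<close>.
\<close>

section \<open>Pointwise estimate of the integrand on one shell\<close>

text \<open>In the application \<open>a\<close>, \<open>b\<close> are the values of \<open>f\<close>
  at \<open>x + h\<close> and \<open>x\<close>, \<open>u\<close>, \<open>v\<close> those of
  \<open>g\<close>, and \<open>r\<close> is the norm of \<open>h\<close>. On the shell,
  \<open>1 / r ^ d\<close> is at most its value at the inner radius, and the logarithmic factor is
  \<open>ln (1 / r) powr (p - 1)\<close>, increasing in the logarithm because
  \<open>p \<ge> 1\<close>. The bracket on the right splits into one term for each way of bounding
  the numerator.\<close>

lemma shell_pointwise_bound:
  fixes r a b u v p :: real and k d :: nat
  assumes "p \<ge> 1" "exp (- (real k + 1)) < r" "r \<le> exp (- real k)"
    and "\<bar>a - b\<bar> \<le> r * exp (u + v)"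
  shows "min 1 (\<bar>a - b\<bar>\<^sup>2) / r ^ d * (1 / ln (1 / r) powr (1 - p))
    \<le> exp (real d * (real k + 1)) * (real k + 1) powr (p - 1) *
      (indicator {real k / 4<..} u + indicator {real k / 4<..} v + (\<bar>a\<bar> + \<bar>b\<bar>) * exp (- real k / 2))"
proof -
  let ?L = "ln (1 / r)"
  have r: "0 < r" using assms(2) by (rule order.strict_trans[OF exp_gt_zero])
  have "ln r > - (real k + 1)" "ln r \<le> - real k"
    using r assms by (metis exp_ln exp_less_cancel_iff, metis exp_ln exp_le_cancel_iff)
  then have L: "real k \<le> ?L" "?L < real k + 1"
    using r by (auto simp: ln_div)
  have "1 / ?L powr (1 - p) = ?L powr (p - 1)"
    using powr_minus_divide[of ?L "1 - p"] by simp
  also have "\<dots> \<le> (real k + 1) powr (p - 1)"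
    using L assms by (intro powr_mono2) linarith+
  finally have log: "1 / ?L powr (1 - p) \<le> (real k + 1) powr (p - 1)" .
  have "1 / r ^ d \<le> 1 / exp (- (real k + 1)) ^ d"
    using r assms by (intro divide_left_mono power_mono mult_pos_pos) auto
  also have "\<dots> = exp (real d * (real k + 1))"
    by (simp only: exp_minus exp_of_nat_mult power_inverse divide_inverse) simp
  finally have pow: "1 / r ^ d \<le> exp (real d * (real k + 1))" .
  have num: "min 1 (\<bar>a - b\<bar>\<^sup>2) \<le> indicator {real k / 4<..} u + indicator {real k / 4<..} v
      + (\<bar>a\<bar> + \<bar>b\<bar>) * exp (- real k / 2)"
  proof (cases "u > real k / 4 \<or> v > real k / 4")
    case True
    then have "1 \<le> (indicator {real k / 4<..} u + indicator {real k / 4<..} v :: real)"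
      by (auto simp: indicator_def)
    moreover have "0 \<le> (\<bar>a\<bar> + \<bar>b\<bar>) * exp (- real k / 2)" by simp
    ultimately show ?thesis by linarith
  next
    case False
    have "\<bar>a - b\<bar> \<le> r * exp (u + v)" by fact
    \<comment> \<open>The threshold \<open>real k / 4\<close> gives
      \<open>u + v \<le> real k / 2\<close>, so half of the decay of \<open>r\<close>
      survives.\<close>
    also have "\<dots> \<le> exp (- real k) * exp (real k / 2)"
      using False r assms by (intro mult_mono) auto
    also have "\<dots> = exp (- real k / 2)" by (simp add: mult_exp_exp)
    finally have small: "\<bar>a - b\<bar> \<le> exp (- real k / 2)" .
    \<comment> \<open>Only one of the two factors is replaced by the small bound; the other goes to
      the triangle inequality, so that the result is linear in \<open>f\<close> and integrable in
      \<open>x\<close>.\<close>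
    have "\<bar>a - b\<bar>\<^sup>2 \<le> (\<bar>a\<bar> + \<bar>b\<bar>) * exp (- real k / 2)"
      unfolding power2_eq_square using small by (intro mult_mono) auto
    then show ?thesis using False by simp
  qed
  have "min 1 (\<bar>a - b\<bar>\<^sup>2) / r ^ d * (1 / ?L powr (1 - p))
      = ((1 / r ^ d) * (1 / ?L powr (1 - p))) * min 1 (\<bar>a - b\<bar>\<^sup>2)" by simp
  also have "\<dots> \<le> (exp (real d * (real k + 1)) * (real k + 1) powr (p - 1)) *
      (indicator {real k / 4<..} u + indicator {real k / 4<..} v + (\<bar>a\<bar> + \<bar>b\<bar>) * exp (- real k / 2))"
    using r by (intro mult_mono[OF mult_mono[OF pow log] num]) auto
  finally show ?thesis .
qed

section \<open>Discrete layer-cake estimate\<close>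

text \<open>At most \<open>4 * \<bar>y\<bar>\<close> indices contribute, each with a weight of at
  most \<open>(8 * \<bar>y\<bar>) powr (p - 1)\<close>. Rounding the count up to
  \<open>8 * \<bar>y\<bar>\<close> turns the product into a single \<open>p\<close>-th
  power.\<close>

lemma sum_powr_levels_le:
  fixes y p :: real
  assumes "p \<ge> 1"
  shows "(\<Sum>n. ennreal ((real n + 2) powr (p - 1)) * indicator {x. (real n + 1) / 4 < x} y)
    \<le> ennreal (8 powr p * \<bar>y\<bar> powr p)"
proof -
  define S where "S = {n. (real n + 1) / 4 < y}"
  have S: "S \<subseteq> {..<nat \<lfloor>4 * \<bar>y\<bar>\<rfloor>}"
    unfolding S_def by (auto) linarith
  then have fin: "finite S" by (rule finite_subset) simp
  have "(\<Sum>n. ennreal ((real n + 2) powr (p - 1)) * indicator {x. (real n + 1) / 4 < x} y)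
      = (\<Sum>n\<in>S. ennreal ((real n + 2) powr (p - 1)))"
    by (subst suminf_finite[OF fin]) (auto simp: S_def indicator_def intro!: sum.cong)
  also have "\<dots> = ennreal (\<Sum>n\<in>S. (real n + 2) powr (p - 1))"
    by (simp add: sum_ennreal)
  \<comment> \<open>For \<open>n\<close> in \<open>S\<close>,
    \<open>n + 2 \<le> 2 * (n + 1) < 8 * y\<close>.\<close>
  also have "\<dots> \<le> ennreal (real (card S) * (8 * \<bar>y\<bar>) powr (p - 1))"
    using assms by (intro ennreal_leI sum_bounded_above powr_mono2) (auto simp: S_def)
  also have "\<dots> \<le> ennreal (8 powr p * \<bar>y\<bar> powr p)"
  proof (rule ennreal_leI)
    have "card S \<le> nat \<lfloor>4 * \<bar>y\<bar>\<rfloor>"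
      using card_mono[OF _ S] by simp
    then have "real (card S) \<le> 8 * \<bar>y\<bar>" by linarith
    then have "real (card S) * (8 * \<bar>y\<bar>) powr (p - 1) \<le> (8 * \<bar>y\<bar>) * (8 * \<bar>y\<bar>) powr (p - 1)"
      by (intro mult_right_mono) auto
    also have "\<dots> = (8 * \<bar>y\<bar>) powr p"
      by (cases "y = 0") (simp_all add: powr_mult_base)
    finally show "real (card S) * (8 * \<bar>y\<bar>) powr (p - 1) \<le> 8 powr p * \<bar>y\<bar> powr p"
      by (simp add: powr_mult)
  qed
  finally show ?thesis .
qed

lemma sum_emeasure_levels_le:
  fixes g :: "'a \<Rightarrow> real" and p :: real
  assumes "p \<ge> 1" and [measurable]: "g \<in> borel_measurable M"
  shows "(\<Sum>n. ennreal ((real n + 2) powr (p - 1)) * emeasure M {x \<in> space M. (real n + 1) / 4 < g x})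
    \<le> ennreal (8 powr p) * (\<integral>\<^sup>+x. ennreal (\<bar>g x\<bar> powr p) \<partial>M)"
proof -
  have level: "c * emeasure M {x \<in> space M. t < g x} = (\<integral>\<^sup>+x. c * indicator {x. t < x} (g x) \<partial>M)"
    for c :: ennreal and t :: real
  proof -
    have "(\<integral>\<^sup>+x. c * indicator {x. t < x} (g x) \<partial>M)
        = (\<integral>\<^sup>+x. c * indicator {x \<in> space M. t < g x} x \<partial>M)"
      by (intro nn_integral_cong) (simp add: indicator_def)
    then show ?thesis by (simp add: nn_integral_cmult_indicator)
  qed
  have "(\<Sum>n. ennreal ((real n + 2) powr (p - 1)) * emeasure M {x \<in> space M. (real n + 1) / 4 < g x})
      = (\<Sum>n. \<integral>\<^sup>+x. ennreal ((real n + 2) powr (p - 1)) * indicator {x. (real n + 1) / 4 < x} (g x) \<partial>M)"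
    by (simp only: level)
  also have "\<dots> = (\<integral>\<^sup>+x. (\<Sum>n. ennreal ((real n + 2) powr (p - 1)) * indicator {x. (real n + 1) / 4 < x} (g x)) \<partial>M)"
    by (rule nn_integral_suminf[symmetric]) measurable
  also have "\<dots> \<le> (\<integral>\<^sup>+x. ennreal (8 powr p) * ennreal (\<bar>g x\<bar> powr p) \<partial>M)"
    using sum_powr_levels_le[OF assms(1)] by (intro nn_integral_mono) (simp add: ennreal_mult)
  also have "\<dots> = ennreal (8 powr p) * (\<integral>\<^sup>+x. ennreal (\<bar>g x\<bar> powr p) \<partial>M)"
    by (rule nn_integral_cmult) measurable
  finally show ?thesis .
qed

section \<open>Translation invariance and norms\<close>

text \<open>A translation is the affine map with all scaling factors 1. Measurability is stated
  between completed measures because \<open>f\<close> and \<open>g\<close> are only Lebesgue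
  measurable, and they get composed with translations.\<close>

lemma
  fixes h :: "'a::euclidean_space"
  shows measurable_lebesgue_translation: "(\<lambda>x. x + h) \<in> lebesgue \<rightarrow>\<^sub>M lebesgue"
    and distr_lebesgue_translation: "distr lebesgue lebesgue (\<lambda>x. x + h) = lebesgue"
proof -
  have eq: "(\<lambda>x. h + (\<Sum>j\<in>Basis. (1 * (x \<bullet> j)) *\<^sub>R j)) = (\<lambda>x. x + h)"
    by (simp add: euclidean_representation add.commute)
  show "(\<lambda>x. x + h) \<in> lebesgue \<rightarrow>\<^sub>M lebesgue"
    using lebesgue_affine_measurable[of "\<lambda>_. 1" h] unfolding eq by simp
  show "distr lebesgue lebesgue (\<lambda>x. x + h) = lebesgue"
    using lebesgue_affine_euclidean[of "\<lambda>_. 1" h] unfolding eq by (simp add: density_1)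
qed

lemma nn_integral_lebesgue_translation:
  fixes u :: "'a::euclidean_space \<Rightarrow> ennreal"
  assumes "u \<in> borel_measurable lebesgue"
  shows "(\<integral>\<^sup>+x. u (x + h) \<partial>lebesgue) = (\<integral>\<^sup>+x. u x \<partial>lebesgue)"
  using nn_integral_distr[OF measurable_lebesgue_translation[of h], of u] assms
  by (simp add: distr_lebesgue_translation)

lemma Lp_norm_nonneg: "Lp_norm p u \<ge> 0"
  by (simp add: Lp_norm_def)

lemma nn_integral_eq_Lp_norm_powr:
  assumes "u \<in> Lp_space p" "p \<noteq> 0"
  shows "(\<integral>\<^sup>+x. ennreal (\<bar>u x\<bar> powr p) \<partial>lebesgue) = ennreal (Lp_norm p u powr p)"
proof -
  have "integrable lebesgue (\<lambda>x. \<bar>u x\<bar> powr p)"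
    using assms by (simp add: Lp_space_def)
  then have "(\<integral>\<^sup>+x. ennreal (\<bar>u x\<bar> powr p) \<partial>lebesgue) = ennreal (LINT x|lebesgue. \<bar>u x\<bar> powr p)"
    by (rule nn_integral_eq_integral) simp
  then show ?thesis using assms by (simp add: Lp_norm_def powr_powr integral_nonneg)
qed

section \<open>Exponential shells\<close>

definition shell :: "nat \<Rightarrow> 'a::euclidean_space set" where
  "shell k = {h. exp (- (real k + 1)) < norm h \<and> norm h \<le> exp (- real k)}"

lemma shell_measurable [measurable]: "shell k \<in> sets lebesgue"
proof -
  have "shell k = cball 0 (exp (- real k)) - (cball 0 (exp (- (real k + 1))) :: 'a set)"
    by (auto simp: shell_def)
  then show ?thesis by simp
qed

text \<open>The volume of the outer ball is a good enough bound: its decay cancels the growth of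
  \<open>1 / norm h ^ DIM('a)\<close> on the shell up to the factor
  \<open>exp DIM('a)\<close>.\<close>

lemma emeasure_shell_le:
  "emeasure lebesgue (shell k :: 'a::euclidean_space set)
    \<le> ennreal (unit_ball_vol DIM('a) * exp (- (real DIM('a) * real k)))"
proof -
  have "emeasure lebesgue (shell k :: 'a set) \<le> emeasure lebesgue (cball 0 (exp (- real k)) :: 'a set)"
    by (rule emeasure_mono) (auto simp: shell_def)
  also have "\<dots> = ennreal (unit_ball_vol DIM('a) * exp (- real k) ^ DIM('a))"
    by (simp add: emeasure_cball)
  also have "exp (- real k) ^ DIM('a) = exp (- (real DIM('a) * real k))"
    by (simp flip: exp_of_nat_mult)
  finally show ?thesis .
qed

text \<open>Since \<open>exp 1 \<le> 3\<close>, the radius 1/3 forces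
  \<open>ln (1 / norm h) > 1\<close>, so the integer part of the logarithm is at least 1 and the
  shell of index 0 does not occur.\<close>

lemma ball_third_shell:
  fixes h :: "'a::euclidean_space"
  assumes "h \<in> ball 0 (1/3)" "h \<noteq> 0"
  obtains n where "h \<in> shell (Suc n)"
proof -
  define L where "L = ln (1 / norm h)"
  have "exp 1 < 1 / norm h"
  proof -
    have "exp 1 \<le> (3 :: real)" by (rule exp_le)
    also have "\<dots> < 1 / norm h" using assms by (simp add: field_simps)
    finally show ?thesis .
  qed
  then have L: "L > 1"
    using assms ln_less_cancel_iff[of "exp 1" "1 / norm h"] by (simp add: L_def)
  define k where "k = nat \<lfloor>L\<rfloor>"
  have k: "real k \<le> L" "L < real k + 1" "k \<ge> 1"
    using L unfolding k_def by linarith+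
  have "norm h = exp (- L)" using assms by (simp add: L_def ln_div)
  then have "h \<in> shell k" using k by (simp add: shell_def)
  then show ?thesis using that[of "k - 1"] k by simp
qed

lemma nn_integral_difference_shell_le:
  fixes f g :: "'a::euclidean_space \<Rightarrow> real"
  assumes p: "p \<ge> 1" and [measurable]: "f \<in> borel_measurable lebesgue" "g \<in> borel_measurable lebesgue"
    and fg: "\<And>x y. \<bar>f x - f y\<bar> \<le> norm (x - y) * exp (g x + g y)"
    and h: "h \<in> shell k"
  shows "(\<integral>\<^sup>+x. ennreal (min 1 (\<bar>f (x + h) - f x\<bar>\<^sup>2) / norm h ^ DIM('a)
                       * (1 / ln (1 / norm h) powr (1 - p))) \<partial>lebesgue)
    \<le> ennreal (exp (real DIM('a) * (real k + 1)) * (real k + 1) powr (p - 1)) *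
      (2 * (emeasure lebesgue {x. real k / 4 < g x} +
        ennreal (exp (- real k / 2)) * (\<integral>\<^sup>+x. ennreal \<bar>f x\<bar> \<partial>lebesgue)))"
proof -
  define w where "w = exp (real DIM('a) * (real k + 1)) * (real k + 1) powr (p - 1)"
  \<comment> \<open>\<open>u\<close> is the cost of one endpoint. The pointwise bound is
    \<open>w * (u (x + h) + u x)\<close>, and translation invariance gives both endpoints the same
    integral, whence the factor 2.\<close>
  define u where "u x = indicator {x. real k / 4 < g x} x + ennreal (exp (- real k / 2)) * ennreal \<bar>f x\<bar>" for x
  have level [measurable]: "{x. real k / 4 < g x} \<in> sets lebesgue"
    using borel_measurable_less[of "\<lambda>_. real k / 4" lebesgue g] by simp
  have w: "w \<ge> 0" by (simp add: w_def)
  have u_eq: "u x = ennreal (indicator {real k / 4<..} (g x) + exp (- real k / 2) * \<bar>f x\<bar>)" for x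
    by (simp add: u_def indicator_def ennreal_mult)
  have u_meas [measurable]: "u \<in> borel_measurable lebesgue"
    unfolding u_def by measurable
  have uh_meas [measurable]: "(\<lambda>x. u (x + h)) \<in> borel_measurable lebesgue"
    using measurable_lebesgue_translation u_meas by (rule measurable_compose)
  have int_u: "(\<integral>\<^sup>+x. u x \<partial>lebesgue) = emeasure lebesgue {x. real k / 4 < g x} +
        ennreal (exp (- real k / 2)) * (\<integral>\<^sup>+x. ennreal \<bar>f x\<bar> \<partial>lebesgue)"
    unfolding u_def using level by (simp add: nn_integral_add nn_integral_cmult)
  have "min 1 (\<bar>f (x + h) - f x\<bar>\<^sup>2) / norm h ^ DIM('a) * (1 / ln (1 / norm h) powr (1 - p))
      \<le> w * (indicator {real k / 4<..} (g (x + h)) + indicator {real k / 4<..} (g x)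
          + (\<bar>f (x + h)\<bar> + \<bar>f x\<bar>) * exp (- real k / 2))" for x
    unfolding w_def using h fg[of "x + h" x] p
    by (intro shell_pointwise_bound) (auto simp: shell_def)
  moreover have "ennreal (w * (indicator {real k / 4<..} (g (x + h)) + indicator {real k / 4<..} (g x)
          + (\<bar>f (x + h)\<bar> + \<bar>f x\<bar>) * exp (- real k / 2))) = ennreal w * (u (x + h) + u x)" for x
    by (simp add: u_eq w flip: ennreal_mult ennreal_plus) (simp add: algebra_simps)
  ultimately have "(\<integral>\<^sup>+x. ennreal (min 1 (\<bar>f (x + h) - f x\<bar>\<^sup>2) / norm h ^ DIM('a)
                       * (1 / ln (1 / norm h) powr (1 - p))) \<partial>lebesgue)
      \<le> (\<integral>\<^sup>+x. ennreal w * (u (x + h) + u x) \<partial>lebesgue)"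
    by (intro nn_integral_mono) (metis ennreal_leI)
  also have "\<dots> = ennreal w * ((\<integral>\<^sup>+x. u (x + h) \<partial>lebesgue) + (\<integral>\<^sup>+x. u x \<partial>lebesgue))"
    by (simp add: nn_integral_cmult nn_integral_add)
  also have "\<dots> = ennreal w * (2 * (\<integral>\<^sup>+x. u x \<partial>lebesgue))"
    by (simp add: nn_integral_lebesgue_translation mult_2)
  finally show ?thesis unfolding int_u w_def .
qed

section \<open>Summation over the shells\<close>

lemma summable_powr_exp: "summable (\<lambda>n. (real n + 2) powr (p - 1) * exp (- (real n + 1) / 2))"
proof (rule summable_comparison_test_bigo)
  show "summable (\<lambda>n. norm (real n powr (-2)))"
    by (simp add: summable_real_powr_iff)
  show "(\<lambda>n. (real n + 2) powr (p - 1) * exp (- (real n + 1) / 2)) \<in> O(\<lambda>n. real n powr (-2))"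
    by real_asymp
qed

theorem proposition2p15:
  fixes p :: real
  assumes "p \<ge> 1"
  shows "\<exists>C::real. C > 0 \<and>
    (\<forall>f :: 'a::euclidean_space \<Rightarrow> real. \<forall>g :: 'a \<Rightarrow> real.
      f \<in> Lp_space 1 \<longrightarrow> g \<in> Lp_space p \<longrightarrow>
      (\<forall>x y. \<bar>f x - f y\<bar> \<le> norm (x - y) * exp (g x + g y)) \<longrightarrow>
      (\<integral>\<^sup>+h\<in>ball 0 (1/3).
         (\<integral>\<^sup>+x. ennreal (min 1 (\<bar>f (x + h) - f x\<bar>\<^sup>2) / norm h ^ DIM('a)
                       * (1 / ln (1 / norm h) powr (1 - p))) \<partial>lebesgue) \<partial>lebesgue)
      \<le> ennreal (C * (Lp_norm p g powr p + Lp_norm 1 f)))"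
proof -
  define d where "d = real DIM('a)"
  \<comment> \<open>\<open>V\<close> bounds the shell volume times the bound for
    \<open>1 / norm h ^ DIM('a)\<close>, uniformly over the shells.\<close>
  define V where "V = unit_ball_vol d * exp d"
  define b where "b n = (real n + 2) powr (p - 1)" for n
  define e where "e n = exp (- (real n + 1) / 2)" for n
  define S where "S = (\<Sum>n. b n * e n)"
  have V: "V > 0" by (simp add: V_def d_def)
  have be: "b n * e n \<ge> 0" for n by (simp add: b_def e_def)
  have sums: "(\<Sum>n. ennreal (b n * e n)) = ennreal S"
    unfolding S_def using summable_powr_exp[of p] be by (intro suminf_ennreal2) (auto simp: b_def e_def)
  have S: "S \<ge> 0" unfolding S_def using summable_powr_exp[of p] be
    by (intro suminf_nonneg) (auto simp: b_def e_def)
  \<comment> \<open>The 2 counts the endpoints, \<open>8 powr p\<close> comes from the level sets of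
    \<open>g\<close>, and \<open>S\<close> from the terms with \<open>f\<close>.\<close>
  define C where "C = 2 * V * (8 powr p + S)"
  have "C > 0" using V S by (simp add: C_def add_pos_nonneg)
  moreover have "(\<integral>\<^sup>+h\<in>ball 0 (1/3).
         (\<integral>\<^sup>+x. ennreal (min 1 (\<bar>f (x + h) - f x\<bar>\<^sup>2) / norm h ^ DIM('a)
                       * (1 / ln (1 / norm h) powr (1 - p))) \<partial>lebesgue) \<partial>lebesgue)
      \<le> ennreal (C * (Lp_norm p g powr p + Lp_norm 1 f))"
    if f: "f \<in> Lp_space 1" and g: "g \<in> Lp_space p"
      and fg: "\<forall>x y. \<bar>f x - f y\<bar> \<le> norm (x - y) * exp (g x + g y)" for f g :: "'a \<Rightarrow> real"
  proof -
    have [measurable]: "f \<in> borel_measurable lebesgue" "g \<in> borel_measurable lebesgue"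
      using f g by (auto simp: Lp_space_def)
    define I where "I h = (\<integral>\<^sup>+x. ennreal (min 1 (\<bar>f (x + h) - f x\<bar>\<^sup>2) / norm h ^ DIM('a)
                       * (1 / ln (1 / norm h) powr (1 - p))) \<partial>lebesgue)" for h
    define F where "F = (\<integral>\<^sup>+x. ennreal \<bar>f x\<bar> \<partial>lebesgue)"
    define m where "m n = emeasure lebesgue {x. (real n + 1) / 4 < g x}" for n
    define K where "K n = ennreal (exp (d * (real n + 2)) * b n) * (2 * (m n + ennreal (e n) * F))" for n
    have I_shell: "I h \<le> K n" if "h \<in> shell (Suc n)" for h n
      using nn_integral_difference_shell_le[OF assms, of f g h "Suc n"] that fg
      by (simp add: I_def K_def d_def b_def m_def e_def F_def add_ac)
    have single_le: "u n \<le> (\<Sum>n. u n)" for u :: "nat \<Rightarrow> ennreal" and n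
      using sum_le_suminf[of u "{n}"] by simp
    have I_ball: "I h * indicator (ball 0 (1/3)) h \<le> (\<Sum>n. K n * indicator (shell (Suc n)) h)" for h
    proof (cases "h \<in> ball 0 (1/3) \<and> h \<noteq> 0")
      case True
      then obtain n where n: "h \<in> shell (Suc n)" using ball_third_shell by blast
      have "I h * indicator (ball 0 (1/3)) h = I h" using True by simp
      also have "\<dots> \<le> K n * indicator (shell (Suc n)) h" using I_shell[OF n] n by simp
      also have "\<dots> \<le> (\<Sum>n. K n * indicator (shell (Suc n)) h)"
        by (rule single_le)
      finally show ?thesis .
    \<comment> \<open>At \<open>h = 0\<close> the difference of \<open>f\<close> vanishes, so
      \<open>I 0 = 0\<close>; off the ball the indicator is 0.\<close>
    qed (auto simp: I_def)
    have K_shell: "K n * emeasure lebesgue (shell (Suc n) :: 'a set)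
        \<le> ennreal (2 * V) * (ennreal (b n) * m n + ennreal (b n * e n) * F)" for n
    proof -
      have "K n * emeasure lebesgue (shell (Suc n) :: 'a set)
          \<le> K n * ennreal (unit_ball_vol d * exp (- (d * (real n + 1))))"
        using emeasure_shell_le[of "Suc n", where 'a = 'a]
        by (intro mult_left_mono) (auto simp: d_def add_ac)
      also have "\<dots> = ennreal (exp (d * (real n + 2)) * b n * (unit_ball_vol d * exp (- (d * (real n + 1)))))
          * (2 * (m n + ennreal (e n) * F))"
        unfolding K_def by (subst ennreal_mult) (auto simp: b_def d_def mult_ac)
      \<comment> \<open>The exponents differ by exactly \<open>d\<close>, so no dependence on
        \<open>n\<close> remains apart from \<open>b n\<close>.\<close>
      also have "exp (d * (real n + 2)) * b n * (unit_ball_vol d * exp (- (d * (real n + 1)))) = V * b n"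
        unfolding V_def by (simp add: algebra_simps flip: exp_add)
      also have "ennreal (V * b n) * (2 * (m n + ennreal (e n) * F))
          = ennreal (2 * V) * (ennreal (b n) * m n + ennreal (b n * e n) * F)"
        using V by (simp add: b_def e_def ennreal_mult algebra_simps)
      finally show ?thesis .
    qed
    have F: "F = ennreal (Lp_norm 1 f)"
      using nn_integral_eq_Lp_norm_powr[OF f] by (simp add: F_def Lp_norm_def)
    have "(\<integral>\<^sup>+h. I h * indicator (ball 0 (1/3)) h \<partial>lebesgue)
        \<le> (\<integral>\<^sup>+h. (\<Sum>n. K n * indicator (shell (Suc n)) h) \<partial>(lebesgue :: 'a measure))"
      by (intro nn_integral_mono I_ball)
    also have "\<dots> = (\<Sum>n. K n * emeasure lebesgue (shell (Suc n) :: 'a set))"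
      by (subst nn_integral_suminf) (auto simp: nn_integral_cmult)
    also have "\<dots> \<le> (\<Sum>n. ennreal (2 * V) * (ennreal (b n) * m n + ennreal (b n * e n) * F))"
      by (intro suminf_le K_shell) auto
    also have "\<dots> = ennreal (2 * V) * ((\<Sum>n. ennreal (b n) * m n) + ennreal S * F)"
      by (simp add: suminf_add[symmetric] sums)
    also have "\<dots> \<le> ennreal (2 * V) * (ennreal (8 powr p) * ennreal (Lp_norm p g powr p) + ennreal S * F)"
      using sum_emeasure_levels_le[OF assms, of g lebesgue] nn_integral_eq_Lp_norm_powr[OF g] assms
      by (intro mult_left_mono add_mono) (auto simp: b_def m_def)
    also have "\<dots> = ennreal (2 * V * (8 powr p * Lp_norm p g powr p + S * Lp_norm 1 f))"
      using V S by (simp add: F Lp_norm_nonneg flip: ennreal_mult ennreal_plus)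
    also have "\<dots> \<le> ennreal (C * (Lp_norm p g powr p + Lp_norm 1 f))"
    proof (rule ennreal_leI)
      have "8 powr p * Lp_norm p g powr p + S * Lp_norm 1 f
          \<le> (8 powr p + S) * (Lp_norm p g powr p + Lp_norm 1 f)"
        using S by (simp add: algebra_simps Lp_norm_nonneg)
      then show "2 * V * (8 powr p * Lp_norm p g powr p + S * Lp_norm 1 f)
          \<le> C * (Lp_norm p g powr p + Lp_norm 1 f)"
        unfolding C_def mult.assoc[of "2 * V"] using V by (intro mult_left_mono) auto
    qed
    finally show ?thesis unfolding I_def .
  qed
  ultimately show ?thesis by blast
qed

end
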